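(* Let $n\ge3$, $\tau>0$, $c\in\mathbb R^{|\mathcal E|}$. Consider the entropy-regularized problem $$\min_{p\in\Delta(\mathcal U_r)}\ \sum_{U\in\mathcal U_r}p(U)\langle c,x_U\rangle+\tau\sum_{U\in\mathcal U_r}p(U)\log p(U)\quad\text{s.t.}\quad \sum_{U\in\mathcal U_r}p(U)d_i(U)=2,\ \ i\in\bar V.$$ Its Lagrange dual (dualizing the degree constraints, with multipliers $\lambda_i$, $i\in\bar V$, and keeping $p\in\Delta(\mathcal U_r)$ as the domain) is $$\max_{\lambda\in\mathbb R^{n-1}}\Phi_\tau(c,\lambda),\qquad \Phi_\tau(c,\lambda):=-\tau\log Z_r(c+A\lambda)-2\,\mathbf 1^\top\lambda .$$ Moreover, for all $\lambda\in\mathbb R^{n-1}$ and $i,j\in\bar V$, $$\frac{\partial\Phi_\tau(c,\lambda)}{\partial\lambda_i}=\mathbb E_{q_{c+A\lambda}}[d_i(U)]-2,\qquad \frac{\partial^2\Phi_\tau(c,\lambda)}{\partial\lambda_i\partial\lambda_j}=-\frac1\tau\operatorname{Cov}_{q_{c+A\lambda}}\bigl(d_i(U),d_j(U)\bigr).$$ Hence $\Phi_\tau(c,\lambda)$ is concave in $\lambda$, and any stationary maximizer $\lambda^\star(c)$ satisfies $\mathbb E_{q_{c+A\lambda^\star(c)}}[d_i(U)]=2$ for all $i\in\bar V$.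
   Context: Let $V=\{1,\dots,n\}$, $n\ge3$, and let $\mathcal E$ be the edge set of the complete undirected graph on $V$. Fix a root $r\in V$ and set $\bar V:=V\setminus\{r\}$. A rooted $1$-tree is an edge set $U\subseteq\mathcal E$ consisting of the edges of a spanning tree of the complete graph on $\bar V$ together with exactly two distinct edges incident to $r$. $\mathcal U_r$ is the set of all rooted $1$-trees and $\Delta(\mathcal U_r)$ the probability simplex over $\mathcal U_r$ (with $0\log0=0$). For $U\in\mathcal U_r$, $x_U\in\{0,1\}^{|\mathcal E|}$ is its edge-incidence vector and $d_i(U)$ the degree of node $i$ in $U$. With temperature $\tau>0$ and $\eta\in\mathbb R^{|\mathcal E|}$, the Gibbs law is $q_\eta(U)=\frac{1}{Z_r(\eta)}\exp(-\frac1\tau\langle\eta,x_U\rangle)$, $U\in\mathcal U_r$, with $Z_r(\eta)=\sum_{U\in\mathcal U_r}\exp(-\frac1\tau\langle\eta,x_U\rangle)$. Vectors $\lambda\in\mathbb R^{n-1}$ are indexed by $\bar V$, and the linear lift $A:\mathbb R^{n-1}\to\mathbb R^{|\mathcal E|}$ is $(A\lambda)_{ij}=\lambda_i+\lambda_j$ for $i,j\in\bar V$ and $(A\lambda)_{rk}=\lambda_k$ for $k\in\bar V$. $\mathbf 1$ is the all-ones vector. *)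

theory Defs
  imports "HOL-Analysis.Analysis"
begin

subsection \<open>Rooted 1-trees\<close>

text \<open>An undirected edge is a two-element set of nodes.\<close>

definition complete_edges :: "'v set \<Rightarrow> 'v set set" where
  "complete_edges W = {e. e \<subseteq> W \<and> card e = 2}"

definition connects :: "'v set set \<Rightarrow> 'v set \<Rightarrow> bool" where
  "connects T W \<longleftrightarrow> (\<forall>u\<in>W. \<forall>v\<in>W. (u, v) \<in> {(a, b). {a, b} \<in> T}\<^sup>*)"

definition is_cycle :: "'v set set \<Rightarrow> 'v list \<Rightarrow> bool" where
  "is_cycle T vs \<longleftrightarrow> length vs \<ge> 3 \<and> distinct vs \<and>
     (\<forall>i<length vs. {vs ! i, vs ! (Suc i mod length vs)} \<in> T)"

definition spanning_tree :: "'v set \<Rightarrow> 'v set set \<Rightarrow> bool" where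
  "spanning_tree W T \<longleftrightarrow> T \<subseteq> complete_edges W \<and> connects T W \<and> \<not> (\<exists>vs. is_cycle T vs)"

definition nodes :: "nat \<Rightarrow> nat set" where
  "nodes n = {1..n}"

definition nonroot :: "nat \<Rightarrow> nat \<Rightarrow> nat set" where
  "nonroot n r = nodes n - {r}"

definition edges :: "nat \<Rightarrow> nat set set" where
  "edges n = complete_edges (nodes n)"

definition rooted_one_trees :: "nat \<Rightarrow> nat \<Rightarrow> nat set set set" where
  "rooted_one_trees n r = {T \<union> {{r, k}, {r, l}} | T k l.
     spanning_tree (nonroot n r) T \<and> k \<in> nonroot n r \<and> l \<in> nonroot n r \<and> k \<noteq> l}"

definition degree_in :: "'v set set \<Rightarrow> 'v \<Rightarrow> nat" where
  "degree_in U i = card {e \<in> U. i \<in> e}"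

subsection \<open>Vectors and partial derivatives over a finite index set\<close>

text \<open>
  A vector of real numbers indexed by a set I is an extensional function on I, so that
  \<open>rvec I\<close> is exactly the coordinate space with one coordinate for each element of I.
\<close>

definition rvec :: "'i set \<Rightarrow> ('i \<Rightarrow> real) set" where
  "rvec I = I \<rightarrow>\<^sub>E UNIV"

definition has_partial :: "(('i \<Rightarrow> real) \<Rightarrow> real) \<Rightarrow> 'i \<Rightarrow> real \<Rightarrow> ('i \<Rightarrow> real) \<Rightarrow> bool" where
  "has_partial f i D x \<longleftrightarrow> ((\<lambda>t. f (x(i := t))) has_real_derivative D) (at (x i))"

definition partial :: "'i \<Rightarrow> (('i \<Rightarrow> real) \<Rightarrow> real) \<Rightarrow> ('i \<Rightarrow> real) \<Rightarrow> real" where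
  "partial i f x = deriv (\<lambda>t. f (x(i := t))) (x i)"

text \<open>
  The library's \<open>concave_on\<close> needs a type of class \<open>real_vector\<close>;
  this is the same notion for the coordinate space \<open>rvec I\<close>.
\<close>

definition concave_rvec :: "'i set \<Rightarrow> (('i \<Rightarrow> real) \<Rightarrow> real) \<Rightarrow> bool" where
  "concave_rvec I f \<longleftrightarrow> (\<forall>x\<in>rvec I. \<forall>y\<in>rvec I. \<forall>u\<ge>0. \<forall>v\<ge>0. u + v = 1 \<longrightarrow>
     f (\<lambda>i\<in>I. u * x i + v * y i) \<ge> u * f x + v * f y)"

definition maximizer :: "'a set \<Rightarrow> ('a \<Rightarrow> real) \<Rightarrow> 'a \<Rightarrow> bool" where
  "maximizer S f x \<longleftrightarrow> x \<in> S \<and> (\<forall>y\<in>S. f y \<le> f x)"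

definition stationary :: "'i set \<Rightarrow> (('i \<Rightarrow> real) \<Rightarrow> real) \<Rightarrow> ('i \<Rightarrow> real) \<Rightarrow> bool" where
  "stationary I f x \<longleftrightarrow> x \<in> rvec I \<and> (\<forall>i\<in>I. has_partial f i 0 x)"

subsection \<open>Lagrange duality for equality-constrained minimization\<close>

text \<open>
  Minimize \<open>objective p\<close> over \<open>p \<in> domain\<close> subject to \<open>lhs i p = rhs i\<close> for all
  \<open>i \<in> index\<close>. Only these equalities are dualized; \<open>domain\<close> stays implicit.
\<close>

record ('p, 'i) eq_program =
  domain :: "'p set"
  objective :: "'p \<Rightarrow> real"
  index :: "'i set"
  lhs :: "'i \<Rightarrow> 'p \<Rightarrow> real"
  rhs :: "'i \<Rightarrow> real"

definition lagrangian :: "('p, 'i) eq_program \<Rightarrow> 'p \<Rightarrow> ('i \<Rightarrow> real) \<Rightarrow> real" where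
  "lagrangian P p l = objective P p + (\<Sum>i\<in>index P. l i * (lhs P i p - rhs P i))"

text \<open>The infimum is taken in the extended reals, so that it is meaningful without assumptions.\<close>

definition dual_objective :: "('p, 'i) eq_program \<Rightarrow> ('i \<Rightarrow> real) \<Rightarrow> ereal" where
  "dual_objective P l = (INF p\<in>domain P. ereal (lagrangian P p l))"

definition dual_value :: "('p, 'i) eq_program \<Rightarrow> ereal" where
  "dual_value P = (SUP l\<in>rvec (index P). dual_objective P l)"

subsection \<open>The entropy-regularized 1-tree problem\<close>

definition prob_simplex :: "'a set \<Rightarrow> ('a \<Rightarrow> real) set" where
  "prob_simplex S = {p \<in> S \<rightarrow>\<^sub>E {0..}. (\<Sum>x\<in>S. p x) = 1}"

definition expect :: "'a set \<Rightarrow> ('a \<Rightarrow> real) \<Rightarrow> ('a \<Rightarrow> real) \<Rightarrow> real" where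
  "expect S p f = (\<Sum>x\<in>S. p x * f x)"

definition covar :: "'a set \<Rightarrow> ('a \<Rightarrow> real) \<Rightarrow> ('a \<Rightarrow> real) \<Rightarrow> ('a \<Rightarrow> real) \<Rightarrow> real" where
  "covar S p f g = expect S p (\<lambda>x. (f x - expect S p f) * (g x - expect S p g))"

definition incidence :: "nat set set \<Rightarrow> nat set \<Rightarrow> real" where
  "incidence U e = (if e \<in> U then 1 else 0)"

definition edge_inner :: "nat \<Rightarrow> (nat set \<Rightarrow> real) \<Rightarrow> (nat set \<Rightarrow> real) \<Rightarrow> real" where
  "edge_inner n x y = (\<Sum>e\<in>edges n. x e * y e)"

text \<open>The convention \<open>0 log 0 = 0\<close> holds automatically for the library's \<open>ln\<close>.\<close>

definition entropic_program ::
    "nat \<Rightarrow> nat \<Rightarrow> real \<Rightarrow> (nat set \<Rightarrow> real) \<Rightarrow> (nat set set \<Rightarrow> real, nat) eq_program" where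
  "entropic_program n r \<tau> c = \<lparr>
     domain = prob_simplex (rooted_one_trees n r),
     objective = (\<lambda>p. (\<Sum>U\<in>rooted_one_trees n r. p U * edge_inner n c (incidence U))
                      + \<tau> * (\<Sum>U\<in>rooted_one_trees n r. p U * ln (p U))),
     index = nonroot n r,
     lhs = (\<lambda>i p. \<Sum>U\<in>rooted_one_trees n r. p U * real (degree_in U i)),
     rhs = (\<lambda>i. 2)\<rparr>"

definition partition_fun :: "nat \<Rightarrow> nat \<Rightarrow> real \<Rightarrow> (nat set \<Rightarrow> real) \<Rightarrow> real" where
  "partition_fun n r \<tau> \<eta> =
     (\<Sum>U\<in>rooted_one_trees n r. exp (- (1 / \<tau>) * edge_inner n \<eta> (incidence U)))"

definition gibbs :: "nat \<Rightarrow> nat \<Rightarrow> real \<Rightarrow> (nat set \<Rightarrow> real) \<Rightarrow> nat set set \<Rightarrow> real" where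
  "gibbs n r \<tau> \<eta> U =
     exp (- (1 / \<tau>) * edge_inner n \<eta> (incidence U)) / partition_fun n r \<tau> \<eta>"

text \<open>
  The sum over the non-root endpoints of e: it is \<open>l i + l j\<close> on an edge \<open>{i, j}\<close> avoiding the
  root r, and \<open>l k\<close> on an edge \<open>{r, k}\<close>.
\<close>

definition lift_edges :: "nat \<Rightarrow> nat \<Rightarrow> (nat \<Rightarrow> real) \<Rightarrow> nat set \<Rightarrow> real" where
  "lift_edges n r l = (\<lambda>e\<in>edges n. \<Sum>k\<in>e - {r}. l k)"

definition shifted_cost ::
    "nat \<Rightarrow> nat \<Rightarrow> (nat set \<Rightarrow> real) \<Rightarrow> (nat \<Rightarrow> real) \<Rightarrow> nat set \<Rightarrow> real" where
  "shifted_cost n r c l = (\<lambda>e\<in>edges n. c e + lift_edges n r l e)"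

definition Phi ::
    "nat \<Rightarrow> nat \<Rightarrow> real \<Rightarrow> (nat set \<Rightarrow> real) \<Rightarrow> (nat \<Rightarrow> real) \<Rightarrow> real" where
  "Phi n r \<tau> c l =
     - \<tau> * ln (partition_fun n r \<tau> (shifted_cost n r c l)) - 2 * (\<Sum>i\<in>nonroot n r. l i)"

end

theory Submission
  imports Defs
begin

text \<open>
  Summing the lifted multipliers over the edges of a 1-tree gives
  \<open>\<langle>c + A\<lambda>, x\<^sub>U\<rangle> = \<langle>c, x\<^sub>U\<rangle> + \<Sum>\<^sub>i \<lambda>\<^sub>i d\<^sub>i(U)\<close>, so the Lagrangian at \<open>\<lambda>\<close> is the free energy of \<open>p\<close> for the cost
  \<open>c + A\<lambda>\<close>, up to the constant \<open>2 \<Sum>\<^sub>i \<lambda>\<^sub>i\<close>. By \<open>ln x \<le> x - 1\<close> the free energy is minimized by the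
  Gibbs law, with value \<open>-\<tau> log Z\<close>. Concavity follows since the dual is an attained minimum of
  functions affine in \<open>\<lambda>\<close>; the derivatives are those of a log-partition function along a line.
\<close>

section \<open>Gibbs variational principle on a finite set\<close>

text \<open>The gap between the two sides is \<open>\<tau>\<close> times the relative entropy of
  \<open>p\<close> with respect to the Gibbs law \<open>w\<close>, so this is Gibbs'
  inequality.\<close>

lemma free_energy_ge_log_partition:
  fixes E p :: "'a \<Rightarrow> real"
  assumes "finite S" "S \<noteq> {}" "\<tau> > 0" "p \<in> prob_simplex S"
  shows "- \<tau> * ln (\<Sum>x\<in>S. exp (- (1 / \<tau>) * E x))
           \<le> (\<Sum>x\<in>S. p x * E x) + \<tau> * (\<Sum>x\<in>S. p x * ln (p x))"
proof -
  define Z where "Z = (\<Sum>x\<in>S. exp (- (1 / \<tau>) * E x))"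
  define w where "w x = exp (- (1 / \<tau>) * E x) / Z" for x
  have Zpos: "Z > 0"
    unfolding Z_def using assms(1,2) by (intro sum_pos) auto
  have wpos: "w x > 0" for x
    using Zpos by (simp add: w_def)
  have p1: "(\<Sum>x\<in>S. p x) = 1" and p0: "\<And>x. x \<in> S \<Longrightarrow> p x \<ge> 0"
    using assms(4) by (auto simp: prob_simplex_def)
  have w1: "(\<Sum>x\<in>S. w x) = 1"
    using Zpos by (simp add: w_def Z_def flip: sum_divide_distrib)
  have lnw: "\<tau> * ln (w x) = - E x - \<tau> * ln Z" for x
    using Zpos assms(3) by (simp add: w_def ln_div algebra_simps)
  \<comment> \<open>Where \<open>p x = 0\<close> the left side vanishes and the right side is
    positive; elsewhere this is \<open>ln y \<le> y - 1\<close> at \<open>y = w x / p x\<close>.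
    After summation the right side is zero, because \<open>w\<close> and \<open>p\<close> both have
    mass one.\<close>
  have "p x * ln (w x) - p x * ln (p x) \<le> w x - p x" if "x \<in> S" for x
  proof (cases "p x = 0")
    case True
    then show ?thesis using wpos[of x] by simp
  next
    case False
    then have px: "p x > 0" using p0[OF that] by simp
    then have "p x * ln (w x / p x) \<le> p x * (w x / p x - 1)"
      using wpos[of x] by (intro mult_left_mono ln_le_minus_one) auto
    moreover have "p x * (w x / p x - 1) = w x - p x"
      using px by (simp add: field_simps)
    ultimately show ?thesis
      using px wpos[of x] by (simp add: ln_div right_diff_distrib)
  qed
  then have "(\<Sum>x\<in>S. p x * ln (w x) - p x * ln (p x)) \<le> (\<Sum>x\<in>S. w x - p x)"
    by (intro sum_mono)
  then have "(\<Sum>x\<in>S. p x * ln (w x)) \<le> (\<Sum>x\<in>S. p x * ln (p x))"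
    unfolding sum_subtractf p1 w1 by simp
  then have "\<tau> * (\<Sum>x\<in>S. p x * ln (w x)) \<le> \<tau> * (\<Sum>x\<in>S. p x * ln (p x))"
    using assms(3) by (intro mult_left_mono) auto
  moreover have "\<tau> * (\<Sum>x\<in>S. p x * ln (w x)) = - (\<Sum>x\<in>S. p x * E x) - \<tau> * ln Z"
  proof -
    have "\<tau> * (\<Sum>x\<in>S. p x * ln (w x)) = (\<Sum>x\<in>S. p x * (\<tau> * ln (w x)))"
      by (simp add: sum_distrib_left mult.left_commute)
    also have "\<dots> = (\<Sum>x\<in>S. - (p x * E x) - p x * (\<tau> * ln Z))"
      unfolding lnw by (simp add: right_diff_distrib)
    also have "\<dots> = - (\<Sum>x\<in>S. p x * E x) - (\<Sum>x\<in>S. p x) * (\<tau> * ln Z)"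
      by (simp add: sum_subtractf sum_negf sum_distrib_right)
    finally show ?thesis by (simp add: p1)
  qed
  ultimately show ?thesis
    unfolding Z_def by linarith
qed

text \<open>For the Gibbs law, \<open>E x + \<tau> * ln (p x)\<close> does not depend on
  \<open>x\<close>, so its average under \<open>p\<close> is that constant.\<close>

lemma gibbs_law_attains_log_partition:
  fixes E :: "'a \<Rightarrow> real"
  assumes "finite S" "S \<noteq> {}" "\<tau> > 0"
  obtains p where "p \<in> prob_simplex S"
    "(\<Sum>x\<in>S. p x * E x) + \<tau> * (\<Sum>x\<in>S. p x * ln (p x))
       = - \<tau> * ln (\<Sum>x\<in>S. exp (- (1 / \<tau>) * E x))"
proof -
  define Z where "Z = (\<Sum>x\<in>S. exp (- (1 / \<tau>) * E x))"
  \<comment> \<open>The restriction to \<open>S\<close> is there because the simplex consists of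
    extensional functions.\<close>
  define p where "p = (\<lambda>x\<in>S. exp (- (1 / \<tau>) * E x) / Z)"
  have Zpos: "Z > 0"
    unfolding Z_def using assms(1,2) by (intro sum_pos) auto
  have p1: "(\<Sum>x\<in>S. p x) = 1"
    using Zpos by (simp add: p_def Z_def flip: sum_divide_distrib)
  have "p \<in> prob_simplex S"
    using p1 Zpos by (auto simp: prob_simplex_def p_def)
  moreover have "(\<Sum>x\<in>S. p x * E x) + \<tau> * (\<Sum>x\<in>S. p x * ln (p x)) = - \<tau> * ln Z"
  proof -
    have lnp: "E x + \<tau> * ln (p x) = - \<tau> * ln Z" if "x \<in> S" for x
      using that Zpos assms(3) by (simp add: p_def ln_div algebra_simps)
    have "(\<Sum>x\<in>S. p x * E x) + \<tau> * (\<Sum>x\<in>S. p x * ln (p x))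
            = (\<Sum>x\<in>S. p x * (E x + \<tau> * ln (p x)))"
      by (simp add: sum_distrib_left sum.distrib distrib_left mult.left_commute)
    also have "\<dots> = (\<Sum>x\<in>S. p x) * (- \<tau> * ln Z)"
      unfolding sum_distrib_right by (intro sum.cong refl) (simp only: lnp)
    finally show ?thesis by (simp add: p1)
  qed
  ultimately show thesis
    using that unfolding Z_def by blast
qed

section \<open>Derivatives of log-partition functions along a line\<close>

text \<open>The weight \<open>g\<close> lets one formula serve both the partition function
  (\<open>g = 1\<close>) and the numerators of Gibbs expectations.\<close>

lemma DERIV_weighted_exp_sum:
  fixes a f g :: "'a \<Rightarrow> real"
  shows "((\<lambda>t. \<Sum>x\<in>S. exp (- (1 / \<tau>) * (a x + t * f x)) * g x) has_real_derivative
          - (1 / \<tau>) * (\<Sum>x\<in>S. exp (- (1 / \<tau>) * (a x + t * f x)) * (f x * g x))) (at t)"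
  unfolding sum_distrib_left
  by (rule DERIV_sum, (rule derivative_eq_intros refl)+) (simp add: algebra_simps)

text \<open>In the chain rule the outer factor \<open>- \<tau>\<close> cancels the inner
  \<open>- (1 / \<tau>)\<close>, which leaves the mean of the slopes \<open>f\<close> with a
  positive sign.\<close>

lemma DERIV_log_partition:
  fixes a f :: "'a \<Rightarrow> real"
  assumes "finite S" "S \<noteq> {}" "\<tau> > 0"
  shows "((\<lambda>t. - \<tau> * ln (\<Sum>x\<in>S. exp (- (1 / \<tau>) * (a x + t * f x)))) has_real_derivative
           expect S (\<lambda>x. exp (- (1 / \<tau>) * (a x + t * f x))
                       / (\<Sum>y\<in>S. exp (- (1 / \<tau>) * (a y + t * f y)))) f) (at t)"
proof -
  let ?Z = "\<lambda>t. \<Sum>x\<in>S. exp (- (1 / \<tau>) * (a x + t * f x))"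
  let ?N = "\<Sum>x\<in>S. exp (- (1 / \<tau>) * (a x + t * f x)) * f x"
  have Zpos: "?Z t > 0"
    using assms(1,2) by (intro sum_pos) auto
  have dZ: "(?Z has_real_derivative - (1 / \<tau>) * ?N) (at t)"
    using DERIV_weighted_exp_sum[of \<tau> a f "\<lambda>_. 1" S t] by simp
  have "((\<lambda>t. - \<tau> * ln (?Z t)) has_real_derivative
          - \<tau> * (1 / ?Z t * (- (1 / \<tau>) * ?N))) (at t)"
    by (rule DERIV_cmult, rule DERIV_chain2[where f = ln, OF DERIV_ln_divide[OF Zpos] dZ])
  moreover have "- \<tau> * (1 / ?Z t * (- (1 / \<tau>) * ?N)) = ?N / ?Z t"
    using assms(3) Zpos by (simp add: field_simps)
  ultimately show ?thesis
    by (simp add: expect_def sum_divide_distrib)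
qed

text \<open>Total mass one collapses the constant term of the expanded product. The resulting form
  is the one the quotient rule produces.\<close>

lemma covar_eq:
  fixes p f g :: "'a \<Rightarrow> real"
  assumes "(\<Sum>x\<in>S. p x) = 1"
  shows "covar S p f g = expect S p (\<lambda>x. f x * g x) - expect S p f * expect S p g"
proof -
  define F G where "F = expect S p f" and "G = expect S p g"
  have "covar S p f g = (\<Sum>x\<in>S. p x * (f x * g x) - p x * f x * G - p x * g x * F + p x * (F * G))"
    unfolding covar_def F_def[symmetric] G_def[symmetric] unfolding expect_def
    by (intro sum.cong) (simp_all add: algebra_simps)
  also have "\<dots> = expect S p (\<lambda>x. f x * g x) - F * G - G * F + (\<Sum>x\<in>S. p x) * (F * G)"
    unfolding sum.distrib sum_subtractf F_def G_def
    by (simp add: expect_def flip: sum_distrib_right)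
  finally show ?thesis
    by (simp add: assms F_def G_def mult.commute)
qed

text \<open>Quotient rule: differentiating the numerator gives the mean of the product
  \<open>f x * g x\<close>, differentiating the normalization gives the product of the
  means.\<close>

lemma DERIV_gibbs_expectation:
  fixes a f g :: "'a \<Rightarrow> real" and \<tau> :: real
  assumes "finite S" "S \<noteq> {}"
  defines "q \<equiv> \<lambda>t x. exp (- (1 / \<tau>) * (a x + t * f x))
                      / (\<Sum>y\<in>S. exp (- (1 / \<tau>) * (a y + t * f y)))"
  shows "((\<lambda>t. expect S (q t) g) has_real_derivative - (1 / \<tau>) * covar S (q t) f g) (at t)"
proof -
  let ?w = "\<lambda>t x. exp (- (1 / \<tau>) * (a x + t * f x))"
  let ?Z = "\<lambda>t. \<Sum>x\<in>S. ?w t x"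
  have Zpos: "?Z t > 0" for t
    using assms(1,2) by (intro sum_pos) auto
  have ex: "expect S (q t) h = (\<Sum>x\<in>S. ?w t x * h x) / ?Z t" for t h
    by (simp add: expect_def q_def sum_divide_distrib)
  have dZ: "(?Z has_real_derivative - (1 / \<tau>) * (\<Sum>x\<in>S. ?w t x * f x)) (at t)"
    using DERIV_weighted_exp_sum[of \<tau> a f "\<lambda>_. 1" S t] by simp
  define N where "N h = (\<Sum>x\<in>S. ?w t x * h x)" for h
  have "(\<Sum>x\<in>S. q t x) = 1"
    using Zpos[of t] by (simp add: q_def flip: sum_divide_distrib)
  then have cov: "covar S (q t) f g = N (\<lambda>x. f x * g x) / ?Z t - N f / ?Z t * (N g / ?Z t)"
    by (simp add: covar_eq ex N_def)
  have "((\<lambda>t. (\<Sum>x\<in>S. ?w t x * g x) / ?Z t) has_real_derivative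
      (- (1 / \<tau>) * N (\<lambda>x. f x * g x) * ?Z t - N g * (- (1 / \<tau>) * N f)) / (?Z t * ?Z t)) (at t)"
    unfolding N_def
    by (rule DERIV_divide[OF DERIV_weighted_exp_sum dZ]) (use Zpos[of t] in simp)
  \<comment> \<open>Stated for arbitrary reals, so that the algebra treats the sums as atoms. At
    \<open>\<tau> = 0\<close> the convention \<open>1 / 0 = 0\<close> makes both sides zero;
    otherwise denominators can be cleared.\<close>
  moreover have "(- (1 / \<tau>) * A * z - B * (- (1 / \<tau>) * C)) / (z * z)
      = - (1 / \<tau>) * (A / z - C / z * (B / z))" if "z > 0" for A B C z :: real
    using that by (cases "\<tau> = 0") (simp_all add: field_simps)
  note this[OF Zpos[of t]]
  ultimately show ?thesis
    unfolding ex cov by (rule DERIV_cong)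
qed

section \<open>Rooted 1-trees form a finite nonempty set\<close>

text \<open>The star centred at \<open>m\<close> is the witness from which a rooted 1-tree is built
  below. It has no cycle because all its edges contain \<open>m\<close>, whereas three consecutive
  edges of a cycle share no node.\<close>

lemma spanning_tree_star:
  assumes "m \<in> W"
  shows "spanning_tree W {{m, k} | k. k \<in> W - {m}}"
  unfolding spanning_tree_def
proof (intro conjI notI)
  let ?T = "{{m, k} | k. k \<in> W - {m}}"
  let ?R = "{(a, b). {a, b} \<in> ?T}"
  show "?T \<subseteq> complete_edges W"
    using assms by (auto simp: complete_edges_def)
  have to: "(m, k) \<in> ?R\<^sup>*" if "k \<in> W" for k
    using that by (cases "k = m") (auto intro!: r_into_rtrancl)
  have "(k, m) \<in> ?R" if "k \<in> W" "k \<noteq> m" for k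
    using that by (auto simp: insert_commute)
  then have "(k, m) \<in> ?R\<^sup>*" if "k \<in> W" for k
    using that by (cases "k = m") auto
  with to show "connects ?T W"
    unfolding connects_def by (meson rtrancl_trans)
next
  let ?T = "{{m, k} | k. k \<in> W - {m}}"
  assume "\<exists>vs. is_cycle ?T vs"
  then obtain vs where len: "length vs \<ge> 3" and dis: "distinct vs"
    and cyc: "\<And>i. i < length vs \<Longrightarrow> {vs ! i, vs ! (Suc i mod length vs)} \<in> ?T"
    unfolding is_cycle_def by blast
  have mem: "m = vs ! i \<or> m = vs ! (Suc i mod length vs)" if "i < length vs" for i
    using cyc[OF that] by auto
  have neq: "vs ! i \<noteq> vs ! j" if "i < length vs" "j < length vs" "i \<noteq> j" for i j
    using that dis by (simp add: nth_eq_iff_index_eq)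
  have "m = vs ! 0 \<or> m = vs ! 1" "m = vs ! 1 \<or> m = vs ! 2"
    using mem[of 0] mem[of 1] len by (fastforce simp: numeral_2_eq_2)+
  \<comment> \<open>The only alternative is that \<open>m\<close> is both \<open>vs ! 0\<close> and
    \<open>vs ! 2\<close>, which distinctness excludes.\<close>
  then have m1: "m = vs ! 1"
    using neq[of 0 2] len by force
  have "m = vs ! 2 \<or> m = vs ! (3 mod length vs)"
    using mem[of 2] len by (simp add: numeral_3_eq_3)
  \<comment> \<open>In a triangle the index 3 wraps around to 0, otherwise it is 3 itself. Either
    way the third edge misses \<open>vs ! 1\<close>.\<close>
  moreover have "3 mod length vs \<noteq> 1" "3 mod length vs < length vs"
    using len by (cases "length vs = 3"; simp)+
  ultimately show False
    using m1 neq[of 1 2] neq[of 1 "3 mod length vs"] len by force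
qed

lemma finite_edges: "finite (edges n)"
  by (rule finite_subset[of _ "Pow (nodes n)"])
     (auto simp: edges_def complete_edges_def nodes_def)

lemma finite_nonroot: "finite (nonroot n r)"
  by (simp add: nonroot_def nodes_def)

lemma rooted_one_tree_subset_edges:
  assumes "r \<in> nodes n" "U \<in> rooted_one_trees n r"
  shows "U \<subseteq> edges n"
proof -
  obtain T k l where U: "U = T \<union> {{r, k}, {r, l}}"
    and T: "T \<subseteq> complete_edges (nonroot n r)" and kl: "k \<in> nonroot n r" "l \<in> nonroot n r"
    using assms(2) unfolding rooted_one_trees_def spanning_tree_def by blast
  have "complete_edges (nonroot n r) \<subseteq> edges n"
    by (auto simp: edges_def complete_edges_def nonroot_def)
  moreover have "{r, k} \<in> edges n" if "k \<in> nonroot n r" for k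
    using that assms(1) by (auto simp: edges_def complete_edges_def nonroot_def)
  ultimately show ?thesis
    using T kl unfolding U by auto
qed

lemma finite_rooted_one_trees:
  assumes "r \<in> nodes n"
  shows "finite (rooted_one_trees n r)"
  by (rule finite_subset[of _ "Pow (edges n)"])
     (use rooted_one_tree_subset_edges[OF assms] finite_edges in auto)

text \<open>Since \<open>n \<ge> 3\<close> there are two distinct nonroot nodes; a star centred at
  one of them, with the root joined to both, is a rooted 1-tree. This makes the partition function
  positive.\<close>

lemma rooted_one_trees_nonempty:
  assumes "n \<ge> 3" "r \<in> nodes n"
  shows "rooted_one_trees n r \<noteq> {}"
proof -
  have "\<not> card (nonroot n r) \<le> Suc 0"
    using assms by (simp add: nonroot_def nodes_def)
  then obtain k l where "k \<in> nonroot n r" "l \<in> nonroot n r" "k \<noteq> l"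
    using card_le_Suc0_iff_eq[OF finite_nonroot] by blast
  then show ?thesis
    using spanning_tree_star[of k "nonroot n r"] unfolding rooted_one_trees_def by blast
qed

section \<open>Lifted multipliers and node degrees\<close>

text \<open>The adjoint of the lift sends the incidence vector of \<open>U\<close> to its nonroot
  degrees. The proof counts the incident pairs of an edge of \<open>U\<close> and a nonroot node in
  two ways.\<close>

lemma edge_inner_shifted_cost:
  assumes "r \<in> nodes n" "U \<in> rooted_one_trees n r"
  shows "edge_inner n (shifted_cost n r c l) (incidence U)
           = edge_inner n c (incidence U) + (\<Sum>k\<in>nonroot n r. l k * real (degree_in U k))"
proof -
  have sub: "U \<subseteq> edges n"
    by (rule rooted_one_tree_subset_edges[OF assms])
  then have finU: "finite U"
    using finite_edges finite_subset by blast
  have "(\<Sum>e\<in>edges n. lift_edges n r l e * incidence U e) = (\<Sum>e\<in>U. lift_edges n r l e)"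
    using sub finite_edges
    by (intro sum.mono_neutral_cong_right) (auto simp: incidence_def)
  also have "\<dots> = (\<Sum>e\<in>U. \<Sum>k\<in>nonroot n r. if k \<in> e then l k else 0)"
  proof (intro sum.cong refl)
    fix e assume "e \<in> U"
    then have "e - {r} = {k \<in> nonroot n r. k \<in> e}" "e \<in> edges n"
      using sub by (auto simp: edges_def complete_edges_def nonroot_def)
    then show "lift_edges n r l e = (\<Sum>k\<in>nonroot n r. if k \<in> e then l k else 0)"
      using finite_nonroot by (simp add: lift_edges_def sum.inter_filter)
  qed
  also have "\<dots> = (\<Sum>k\<in>nonroot n r. \<Sum>e\<in>U. if k \<in> e then l k else 0)"
    by (rule sum.swap)
  also have "\<dots> = (\<Sum>k\<in>nonroot n r. l k * real (degree_in U k))"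
    using finU by (intro sum.cong) (simp_all add: degree_in_def mult.commute flip: sum.inter_filter)
  finally show ?thesis
    unfolding edge_inner_def shifted_cost_def
    by (simp add: distrib_right sum.distrib)
qed

text \<open>The energy of each tree is affine in a single multiplier, with the degree as slope. This
  is the form \<open>a x + t * f x\<close> of the derivative lemmas, with base point
  \<open>l(i := 0)\<close>.\<close>

lemma edge_inner_shifted_cost_upd:
  assumes "r \<in> nodes n" "U \<in> rooted_one_trees n r" "i \<in> nonroot n r"
  shows "edge_inner n (shifted_cost n r c (l(i := t))) (incidence U)
           = edge_inner n (shifted_cost n r c (l(i := 0))) (incidence U) + t * real (degree_in U i)"
  unfolding edge_inner_shifted_cost[OF assms(1,2)] sum.remove[OF finite_nonroot assms(3)]
  by simp

lemma gibbs_shifted_cost_upd: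
  fixes c :: "nat set \<Rightarrow> real"
  assumes "r \<in> nodes n" "U \<in> rooted_one_trees n r" "i \<in> nonroot n r"
  defines "a \<equiv> \<lambda>l U. edge_inner n (shifted_cost n r c (l(i := 0))) (incidence U)"
  shows "gibbs n r \<tau> (shifted_cost n r c (l(i := t))) U
           = exp (- (1 / \<tau>) * (a l U + t * real (degree_in U i)))
             / (\<Sum>V\<in>rooted_one_trees n r. exp (- (1 / \<tau>) * (a l V + t * real (degree_in V i))))"
proof -
  have "edge_inner n (shifted_cost n r c (l(i := t))) (incidence V)
      = a l V + t * real (degree_in V i)" if "V \<in> rooted_one_trees n r" for V
    unfolding a_def by (rule edge_inner_shifted_cost_upd[OF assms(1) that assms(3)])
  then show ?thesis
    using assms(2) by (simp add: gibbs_def partition_fun_def)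
qed

section \<open>Gradient and Hessian of the dual function\<close>

lemma has_partial_Phi:
  assumes "n \<ge> 3" "r \<in> nodes n" "\<tau> > 0" "i \<in> nonroot n r"
  shows "has_partial (Phi n r \<tau> c) i
           (expect (rooted_one_trees n r) (gibbs n r \<tau> (shifted_cost n r c l))
              (\<lambda>U. real (degree_in U i)) - 2) l"
proof -
  let ?S = "rooted_one_trees n r"
  let ?f = "\<lambda>U. real (degree_in U i)"
  define a where "a U = edge_inner n (shifted_cost n r c (l(i := 0))) (incidence U)" for U
  have E: "edge_inner n (shifted_cost n r c (l(i := t))) (incidence U) = a U + t * ?f U"
    if "U \<in> ?S" for U t
    unfolding a_def by (rule edge_inner_shifted_cost_upd[OF assms(2) that assms(4)])
  have Phi: "Phi n r \<tau> c (l(i := t)) = - \<tau> * ln (\<Sum>U\<in>?S. exp (- (1 / \<tau>) * (a U + t * ?f U)))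
      - 2 * (t + (\<Sum>k\<in>nonroot n r - {i}. l k))" for t
    by (simp add: Phi_def partition_fun_def E sum.remove[OF finite_nonroot assms(4)])
  \<comment> \<open>At \<open>t = l i\<close> the update \<open>l(i := t)\<close> is
    \<open>l\<close> itself, so the law on the line is the Gibbs law at \<open>l\<close>.\<close>
  have "expect ?S (\<lambda>U. exp (- (1 / \<tau>) * (a U + l i * ?f U))
                     / (\<Sum>V\<in>?S. exp (- (1 / \<tau>) * (a V + l i * ?f V)))) ?f
      = expect ?S (gibbs n r \<tau> (shifted_cost n r c l)) ?f"
    using gibbs_shifted_cost_upd[OF assms(2) _ assms(4), of _ \<tau> c l "l i"]
    by (simp add: expect_def a_def cong: sum.cong)
  with DERIV_log_partition[OF finite_rooted_one_trees[OF assms(2)]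
      rooted_one_trees_nonempty[OF assms(1,2)] assms(3), of a ?f "l i"]
  have "((\<lambda>t. - \<tau> * ln (\<Sum>U\<in>?S. exp (- (1 / \<tau>) * (a U + t * ?f U)))) has_real_derivative
      expect ?S (gibbs n r \<tau> (shifted_cost n r c l)) ?f) (at (l i))"
    by simp
  then show ?thesis
    unfolding has_partial_def Phi by (rule DERIV_diff) (auto intro!: derivative_eq_intros)
qed

lemma partial_Phi:
  assumes "n \<ge> 3" "r \<in> nodes n" "\<tau> > 0" "i \<in> nonroot n r"
  shows "partial i (Phi n r \<tau> c) l
           = expect (rooted_one_trees n r) (gibbs n r \<tau> (shifted_cost n r c l))
              (\<lambda>U. real (degree_in U i)) - 2"
  using has_partial_Phi[OF assms] unfolding has_partial_def partial_def
  by (rule DERIV_imp_deriv)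

text \<open>The gradient formula \<open>partial_Phi\<close> holds at every point, so it can be
  rewritten under the varying \<open>t\<close>. What remains is the derivative of the Gibbs mean of
  the degree of \<open>j\<close> in direction \<open>i\<close>.\<close>

lemma has_partial_partial_Phi:
  assumes "n \<ge> 3" "r \<in> nodes n" "\<tau> > 0" "i \<in> nonroot n r" "j \<in> nonroot n r"
  shows "has_partial (partial j (Phi n r \<tau> c)) i
           (- (1 / \<tau>) * covar (rooted_one_trees n r) (gibbs n r \<tau> (shifted_cost n r c l))
              (\<lambda>U. real (degree_in U i)) (\<lambda>U. real (degree_in U j))) l"
proof -
  let ?S = "rooted_one_trees n r"
  let ?f = "\<lambda>i U. real (degree_in U i)"
  define a where "a U = edge_inner n (shifted_cost n r c (l(i := 0))) (incidence U)" for U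
  define q where "q t U = exp (- (1 / \<tau>) * (a U + t * ?f i U))
      / (\<Sum>V\<in>?S. exp (- (1 / \<tau>) * (a V + t * ?f i V)))" for t U
  have q: "gibbs n r \<tau> (shifted_cost n r c (l(i := t))) U = q t U" if "U \<in> ?S" for t U
    using gibbs_shifted_cost_upd[OF assms(2) that assms(4)] by (simp add: q_def a_def)
  have ex: "expect ?S (gibbs n r \<tau> (shifted_cost n r c (l(i := t)))) h = expect ?S (q t) h" for t h
    using q by (simp add: expect_def)
  have cov: "covar ?S (gibbs n r \<tau> (shifted_cost n r c l)) (?f i) (?f j)
      = covar ?S (q (l i)) (?f i) (?f j)"
    using ex[of "l i"] by (simp add: covar_def)
  have "((\<lambda>t. expect ?S (q t) (?f j)) has_real_derivative
          - (1 / \<tau>) * covar ?S (q (l i)) (?f i) (?f j)) (at (l i))"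
    unfolding q_def
    by (rule DERIV_gibbs_expectation[OF finite_rooted_one_trees[OF assms(2)]
        rooted_one_trees_nonempty[OF assms(1,2)]])
  from DERIV_diff[OF this DERIV_const[of 2]] show ?thesis
    unfolding has_partial_def partial_Phi[OF assms(1-3,5)] ex cov by simp
qed

section \<open>Lagrangian, dual function and concavity\<close>

text \<open>Exchanging the sums over trees and nodes absorbs the multipliers into the cost, so for
  fixed \<open>l\<close> the Lagrangian is a free energy minus a constant.\<close>

lemma lagrangian_entropic_program:
  assumes "r \<in> nodes n"
  shows "lagrangian (entropic_program n r \<tau> c) p l
           = (\<Sum>U\<in>rooted_one_trees n r.
                p U * edge_inner n (shifted_cost n r c l) (incidence U))
             + \<tau> * (\<Sum>U\<in>rooted_one_trees n r. p U * ln (p U)) - 2 * (\<Sum>i\<in>nonroot n r. l i)"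
proof -
  let ?S = "rooted_one_trees n r"
  have "(\<Sum>U\<in>?S. p U * (\<Sum>i\<in>nonroot n r. l i * real (degree_in U i)))
      = (\<Sum>i\<in>nonroot n r. l i * (\<Sum>U\<in>?S. p U * real (degree_in U i)))"
    unfolding sum_distrib_left by (subst sum.swap) (simp add: mult.left_commute)
  then have "(\<Sum>U\<in>?S. p U * edge_inner n (shifted_cost n r c l) (incidence U))
      = (\<Sum>U\<in>?S. p U * edge_inner n c (incidence U))
        + (\<Sum>i\<in>nonroot n r. l i * (\<Sum>U\<in>?S. p U * real (degree_in U i)))"
    by (simp add: edge_inner_shifted_cost[OF assms] distrib_left sum.distrib)
  moreover have "lagrangian (entropic_program n r \<tau> c) p l
      = (\<Sum>U\<in>?S. p U * edge_inner n c (incidence U)) + \<tau> * (\<Sum>U\<in>?S. p U * ln (p U))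
        + ((\<Sum>i\<in>nonroot n r. l i * (\<Sum>U\<in>?S. p U * real (degree_in U i)))
           - (\<Sum>i\<in>nonroot n r. l i) * 2)"
    by (simp add: lagrangian_def entropic_program_def right_diff_distrib sum_subtractf
        flip: sum_distrib_right)
  ultimately show ?thesis
    by simp
qed

lemma Phi_le_lagrangian:
  assumes "n \<ge> 3" "r \<in> nodes n" "\<tau> > 0" "p \<in> prob_simplex (rooted_one_trees n r)"
  shows "Phi n r \<tau> c l \<le> lagrangian (entropic_program n r \<tau> c) p l"
  using free_energy_ge_log_partition[OF finite_rooted_one_trees[OF assms(2)]
      rooted_one_trees_nonempty[OF assms(1,2)] assms(3,4)]
  by (simp add: lagrangian_entropic_program[OF assms(2)] Phi_def partition_fun_def)

lemma lagrangian_attains_Phi: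
  assumes "n \<ge> 3" "r \<in> nodes n" "\<tau> > 0"
  obtains p where "p \<in> prob_simplex (rooted_one_trees n r)"
    "lagrangian (entropic_program n r \<tau> c) p l = Phi n r \<tau> c l"
proof -
  obtain p where p: "p \<in> prob_simplex (rooted_one_trees n r)"
    "(\<Sum>U\<in>rooted_one_trees n r. p U * edge_inner n (shifted_cost n r c l) (incidence U))
       + \<tau> * (\<Sum>U\<in>rooted_one_trees n r. p U * ln (p U))
     = - \<tau> * ln (partition_fun n r \<tau> (shifted_cost n r c l))"
    unfolding partition_fun_def
    by (rule gibbs_law_attains_log_partition[OF finite_rooted_one_trees[OF assms(2)]
          rooted_one_trees_nonempty[OF assms(1,2)] assms(3)])
  show thesis
    by (rule that[OF p(1)]) (simp only: lagrangian_entropic_program[OF assms(2)] p(2) Phi_def)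
qed

text \<open>\<open>Phi\<close> is a lower bound of the Lagrangian that some \<open>p\<close>
  attains, so the extended-real infimum is a minimum and finite.\<close>

lemma dual_objective_entropic_program:
  assumes "n \<ge> 3" "r \<in> nodes n" "\<tau> > 0"
  shows "dual_objective (entropic_program n r \<tau> c) l = ereal (Phi n r \<tau> c l)"
proof -
  have dom: "domain (entropic_program n r \<tau> c) = prob_simplex (rooted_one_trees n r)"
    by (simp add: entropic_program_def)
  obtain p where "p \<in> prob_simplex (rooted_one_trees n r)"
    "lagrangian (entropic_program n r \<tau> c) p l = Phi n r \<tau> c l"
    by (rule lagrangian_attains_Phi[OF assms])
  then show ?thesis
    unfolding dual_objective_def dom
    by (intro antisym INF_greatest INF_lower2[of p]) (simp_all add: Phi_le_lagrangian[OF assms])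
qed

text \<open>The constraint terms are linear in the multipliers; \<open>u + v = 1\<close> handles the
  objective, which is constant in them.\<close>

lemma lagrangian_affine:
  assumes "u + v = 1"
  shows "lagrangian P p (\<lambda>i\<in>index P. u * x i + v * y i)
           = u * lagrangian P p x + v * lagrangian P p y"
proof -
  have "objective P p = u * objective P p + v * objective P p"
    using assms by (metis distrib_right mult_1)
  then show ?thesis
    by (simp add: lagrangian_def distrib_left distrib_right sum.distrib sum_distrib_left
        mult.assoc)
qed

lemma concave_Phi:
  assumes "n \<ge> 3" "r \<in> nodes n" "\<tau> > 0"
  shows "concave_rvec (nonroot n r) (Phi n r \<tau> c)"
  unfolding concave_rvec_def
proof (intro ballI allI impI)
  fix x y :: "nat \<Rightarrow> real" and u v :: real
  assume uv: "u \<ge> 0" "v \<ge> 0" "u + v = 1"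
  let ?P = "entropic_program n r \<tau> c"
  let ?z = "\<lambda>i\<in>nonroot n r. u * x i + v * y i"
  have idx: "index ?P = nonroot n r"
    by (simp add: entropic_program_def)
  \<comment> \<open>The minimizer is taken at the intermediate point \<open>?z\<close>. The same
    \<open>p\<close> bounds \<open>Phi\<close> from above at \<open>x\<close> and \<open>y\<close>,
    and affinity carries these bounds to \<open>?z\<close>.\<close>
  obtain p where p: "p \<in> prob_simplex (rooted_one_trees n r)"
    "lagrangian ?P p ?z = Phi n r \<tau> c ?z"
    by (rule lagrangian_attains_Phi[OF assms])
  have "u * Phi n r \<tau> c x + v * Phi n r \<tau> c y \<le> u * lagrangian ?P p x + v * lagrangian ?P p y"
    using uv Phi_le_lagrangian[OF assms p(1)] by (intro add_mono mult_left_mono) auto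
  also have "\<dots> = Phi n r \<tau> c ?z"
    using lagrangian_affine[OF uv(3), of ?P p x y] by (simp add: idx p(2))
  finally show "Phi n r \<tau> c ?z \<ge> u * Phi n r \<tau> c x + v * Phi n r \<tau> c y" .
qed

theorem theorem2p2:
  fixes n r :: nat and \<tau> :: real and c :: "nat set \<Rightarrow> real"
  assumes "n \<ge> 3" and "r \<in> nodes n" and "\<tau> > 0" and "c \<in> rvec (edges n)"
  defines "q \<equiv> \<lambda>l. gibbs n r \<tau> (shifted_cost n r c l)"
    and "d \<equiv> \<lambda>i U. real (degree_in U i)"
  shows "(\<forall>l\<in>rvec (nonroot n r).
            dual_objective (entropic_program n r \<tau> c) l = ereal (Phi n r \<tau> c l))
       \<and> dual_value (entropic_program n r \<tau> c)
            = (SUP l\<in>rvec (nonroot n r). ereal (Phi n r \<tau> c l))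
       \<and> (\<forall>l\<in>rvec (nonroot n r). \<forall>i\<in>nonroot n r.
            has_partial (Phi n r \<tau> c) i
              (expect (rooted_one_trees n r) (q l) (d i) - 2) l)
       \<and> (\<forall>l\<in>rvec (nonroot n r). \<forall>i\<in>nonroot n r. \<forall>j\<in>nonroot n r.
            has_partial (partial j (Phi n r \<tau> c)) i
              (- (1 / \<tau>) * covar (rooted_one_trees n r) (q l) (d i) (d j)) l)
       \<and> concave_rvec (nonroot n r) (Phi n r \<tau> c)
       \<and> (\<forall>l. maximizer (rvec (nonroot n r)) (Phi n r \<tau> c) l
              \<and> stationary (nonroot n r) (Phi n r \<tau> c) l
            \<longrightarrow> (\<forall>i\<in>nonroot n r. expect (rooted_one_trees n r) (q l) (d i) = 2))"
proof (intro conjI ballI allI impI)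
  show dual: "dual_objective (entropic_program n r \<tau> c) l = ereal (Phi n r \<tau> c l)" for l
    by (rule dual_objective_entropic_program[OF assms(1-3)])
  show "dual_value (entropic_program n r \<tau> c)
      = (SUP l\<in>rvec (nonroot n r). ereal (Phi n r \<tau> c l))"
    unfolding dual_value_def dual by (simp add: entropic_program_def)
  show deriv: "has_partial (Phi n r \<tau> c) i (expect (rooted_one_trees n r) (q l) (d i) - 2) l"
    if "i \<in> nonroot n r" for l i
    unfolding q_def d_def by (rule has_partial_Phi[OF assms(1-3) that])
  show "has_partial (partial j (Phi n r \<tau> c)) i
      (- (1 / \<tau>) * covar (rooted_one_trees n r) (q l) (d i) (d j)) l"
    if "i \<in> nonroot n r" "j \<in> nonroot n r" for l i j
    unfolding q_def d_def by (rule has_partial_partial_Phi[OF assms(1-3) that])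
  show "concave_rvec (nonroot n r) (Phi n r \<tau> c)"
    by (rule concave_Phi[OF assms(1-3)])
  show "expect (rooted_one_trees n r) (q l) (d i) = 2"
    if max: "maximizer (rvec (nonroot n r)) (Phi n r \<tau> c) l
        \<and> stationary (nonroot n r) (Phi n r \<tau> c) l"
      and i: "i \<in> nonroot n r" for l i
  proof -
    have "has_partial (Phi n r \<tau> c) i 0 l"
      using max i by (simp add: stationary_def)
    \<comment> \<open>Both zero and the expected degree minus two are the partial derivative at
      \<open>l\<close>, and derivatives are unique.\<close>
    with deriv[OF i, of l] show ?thesis
      unfolding has_partial_def using DERIV_unique by fastforce
  qed
qed

end
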